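(* Let $K\subset\mathbb{R}$ be Borel-measurable, and let $(f_n)_{n\in\mathbb{N}}$ be a sequence of non-negative Borel-measurable functions $f_n:K\to\mathbb{R}$ such that $f_n\leq f_{n+1}$ for all $n\in\mathbb{N}$ and $f_n\to f$ pointwise on $K$, where $f:K\to\mathbb{R}$. Then $$(\mathrm{H})\int_K f_n\ \to\ (\mathrm{H})\int_K f$$ in the order topology on $[0,1]\times[0,+\infty]$.
   Context: The set $[0,1]\times[0,+\infty]$ carries the lexicographic order: $(d_1,m_1)\leq(d_2,m_2)$ iff $d_1<d_2$, or $d_1=d_2$ and $m_1\leq m_2$; the order topology is with respect to this order. $\dim_{\mathrm{H}}$ denotes Hausdorff dimension and $\mu^d$ the $d$-dimensional Hausdorff measure on $\mathbb{R}$ (normalized so that $\mu^0$ is the counting measure and $\mu^1$ is the Lebesgue measure). Hausdorff-integral: for $K\subset\mathbb{R}$ Borel-measurable and $f:K\to\mathbb{R}$ Borel-measurable, let $D_f=\{x\in K: f(x)\neq 0\}$ and set $(\mathrm{H})\int_K f=(d,m)\in[0,1]\times[-\infty,+\infty]$, where $d=\dim_{\mathrm{H}}D_f$ and $m=\int_{D_f}f\,d\mu^d$, with the conventions $\dim_{\mathrm{H}}\emptyset=0$ and $\int_\emptyset f\,d\mu^d=0$. The Hausdorff-integral exists when $\int_{D_f}f\,d\mu^d$ exists in the extended sense (possibly $\pm\infty$); for $f\geq 0$ it always exists and lies in $[0,1]\times[0,+\infty]$. *)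

theory Defs
  imports "HOL-Analysis.Analysis"
begin

subsection \<open>Hausdorff measure and dimension on the real line\<close>

text \<open>
  With no multiplicative constant in front of \<open>(diameter U) powr d\<close>, the case \<open>d = 0\<close> is counting
  measure and \<open>d = 1\<close> is Lebesgue measure (proved below). Since \<open>0 powr 0 = 0\<close> in HOL, the
  exponent \<open>0\<close>, where every nonempty set must count \<open>1\<close>, is treated separately.
  The definitions are only meant for \<open>d \<ge> 0\<close>.
\<close>
definition hausdorff_gauge :: "real \<Rightarrow> real set \<Rightarrow> ennreal" where
  "hausdorff_gauge d U =
     (if U = {} then 0 else if d = 0 then 1 else ennreal (diameter U powr d))"

text \<open>Boundedness is required explicitly because \<^const>\<open>diameter\<close> is unspecified on unbounded sets.\<close>
definition hausdorff_covers :: "real \<Rightarrow> real set \<Rightarrow> (nat \<Rightarrow> real set) set" where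
  "hausdorff_covers \<delta> A =
     {U. A \<subseteq> (\<Union>i. U i) \<and> (\<forall>i. bounded (U i) \<and> diameter (U i) \<le> \<delta>)}"

definition hausdorff_premeasure :: "real \<Rightarrow> real \<Rightarrow> real set \<Rightarrow> ennreal" where
  "hausdorff_premeasure d \<delta> A = (INF U\<in>hausdorff_covers \<delta> A. \<Sum>i. hausdorff_gauge d (U i))"

definition hausdorff_outer_measure :: "real \<Rightarrow> real set \<Rightarrow> ennreal" where
  "hausdorff_outer_measure d A = (SUP \<delta>\<in>{0<..}. hausdorff_premeasure d \<delta> A)"

text \<open>\<open>emeasure_hausdorff_measure\<close> below shows that this is not the degenerate case of \<^const>\<open>measure_of\<close>.\<close>
definition hausdorff_measure :: "real \<Rightarrow> real measure" where
  "hausdorff_measure d = measure_of UNIV (sets borel) (hausdorff_outer_measure d)"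

text \<open>
  The infimum is over a set of reals that is bounded below by \<open>0\<close> and contains every \<open>d > 1\<close>.
  In particular \<open>hausdorff_dim {} = 0\<close>.
\<close>
definition hausdorff_dim :: "real set \<Rightarrow> real" where
  "hausdorff_dim A = Inf {d. 0 \<le> d \<and> hausdorff_outer_measure d A = 0}"


subsection \<open>The Hausdorff-integral\<close>

text \<open>
  A function on \<open>K\<close> is a total function of which only the values on \<open>K\<close> matter.
  The second component is the integral of \<open>f\<close> in the extended sense, i.e. the integral of the
  positive part minus the integral of the negative part; the value is meaningful iff one of the two
  is finite, which always holds for \<open>f \<ge> 0\<close> (for \<open>\<infinity> - \<infinity>\<close> the integral does not exist).
\<close>
definition hausdorff_support :: "real set \<Rightarrow> (real \<Rightarrow> real) \<Rightarrow> real set" where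
  "hausdorff_support K f = {x \<in> K. f x \<noteq> 0}"

definition hausdorff_integral :: "real set \<Rightarrow> (real \<Rightarrow> real) \<Rightarrow> real \<times> ereal" where
  "hausdorff_integral K f =
     (let D = hausdorff_support K f; d = hausdorff_dim D; \<mu> = hausdorff_measure d
      in (d, enn2ereal (\<integral>\<^sup>+x\<in>D. ennreal (f x) \<partial>\<mu>) - enn2ereal (\<integral>\<^sup>+x\<in>D. ennreal (- f x) \<partial>\<mu>)))"


subsection \<open>The lexicographic order topology\<close>

text \<open>
  The type \<^typ>\<open>real \<times> ereal\<close> already carries the componentwise order and the product topology as
  class instances, so the order and its topology are given explicitly on the carrier.
\<close>
definition lex_le :: "real \<times> ereal \<Rightarrow> real \<times> ereal \<Rightarrow> bool" where
  "lex_le p q \<longleftrightarrow> fst p < fst q \<or> fst p = fst q \<and> snd p \<le> snd q"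

definition order_topology_on :: "'a set \<Rightarrow> ('a \<Rightarrow> 'a \<Rightarrow> bool) \<Rightarrow> 'a topology" where
  "order_topology_on C le = topology_generated_by
     ({C} \<union> {{x \<in> C. le x a \<and> x \<noteq> a} |a. a \<in> C} \<union> {{x \<in> C. le a x \<and> x \<noteq> a} |a. a \<in> C})"

definition hausdorff_value_topology :: "(real \<times> ereal) topology" where
  "hausdorff_value_topology = order_topology_on ({0..1} \<times> {0..}) lex_le"


subsection \<open>The measure is well defined and normalized as intended\<close>

lemma hausdorff_covers_mono:
  "\<delta> \<le> \<epsilon> \<Longrightarrow> A \<subseteq> B \<Longrightarrow> hausdorff_covers \<delta> B \<subseteq> hausdorff_covers \<epsilon> A"
  unfolding hausdorff_covers_def by (fastforce intro: order_trans)

lemma hausdorff_premeasure_le: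
  "U \<in> hausdorff_covers \<delta> A \<Longrightarrow> hausdorff_premeasure d \<delta> A \<le> (\<Sum>i. hausdorff_gauge d (U i))"
  unfolding hausdorff_premeasure_def by (rule INF_lower)

lemma hausdorff_premeasure_antimono:
  "\<delta> \<le> \<epsilon> \<Longrightarrow> A \<subseteq> B \<Longrightarrow> hausdorff_premeasure d \<epsilon> A \<le> hausdorff_premeasure d \<delta> B"
  unfolding hausdorff_premeasure_def by (intro INF_superset_mono hausdorff_covers_mono) auto

lemma hausdorff_premeasure_empty: "0 < \<delta> \<Longrightarrow> hausdorff_premeasure d \<delta> {} = 0"
  using hausdorff_premeasure_le[of "\<lambda>_. {}" \<delta> "{}" d]
  by (auto simp: hausdorff_covers_def hausdorff_gauge_def)

lemma hausdorff_premeasure_UN_le: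
  "hausdorff_premeasure d \<delta> (\<Union>n. A n) \<le> (\<Sum>n. hausdorff_premeasure d \<delta> (A n))"
proof (rule ennreal_le_epsilon)
  let ?H = "hausdorff_premeasure d \<delta>"
  fix e :: real
  assume e: "0 < e" and "(\<Sum>n. ?H (A n)) < top"
  then have *: "?H (A n) < ?H (A n) + e * (1/2)^Suc n" for n
    by (auto simp add: less_top dest!: ennreal_suminf_lessD)
  have "\<exists>U\<in>hausdorff_covers \<delta> (A n). (\<Sum>i. hausdorff_gauge d (U i)) < ?H (A n) + e * (1/2)^Suc n" for n
    using *[of n] unfolding hausdorff_premeasure_def[of d \<delta> "A n"] INF_less_iff by blast
  then obtain B where B: "\<And>n. B n \<in> hausdorff_covers \<delta> (A n)"
    and Ble: "\<And>n. (\<Sum>i. hausdorff_gauge d (B n i)) < ?H (A n) + e * (1/2)^Suc n"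
    by metis
  define C where "C = case_prod B \<circ> prod_decode"
  have C: "C (prod_encode (n, i)) = B n i" for n i
    by (simp add: C_def)
  have "(\<Union>n. A n) \<subseteq> (\<Union>k. C k)"
  proof
    fix x assume "x \<in> (\<Union>n. A n)"
    then obtain n i where "x \<in> B n i" using B unfolding hausdorff_covers_def by blast
    then show "x \<in> (\<Union>k. C k)" using C[of n i] by blast
  qed
  moreover have "bounded (C k) \<and> diameter (C k) \<le> \<delta>" for k
    using B by (simp add: C_def hausdorff_covers_def split: prod.split)
  ultimately have "C \<in> hausdorff_covers \<delta> (\<Union>n. A n)"
    by (simp add: hausdorff_covers_def)
  then have "?H (\<Union>n. A n) \<le> (\<Sum>i. hausdorff_gauge d (C i))"
    by (rule hausdorff_premeasure_le)
  also have "\<dots> = (\<Sum>n. \<Sum>i. hausdorff_gauge d (B n i))"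
    using suminf_ennreal_2dimen[of "\<lambda>n. \<Sum>i. hausdorff_gauge d (B n i)" "\<lambda>(n, i). hausdorff_gauge d (B n i)"]
    by (simp add: C_def comp_def split_def)
  also have "\<dots> \<le> (\<Sum>n. ?H (A n) + e * (1/2)^Suc n)"
    using Ble by (intro suminf_le) (auto intro: less_imp_le)
  also have "\<dots> = (\<Sum>n. ?H (A n)) + (\<Sum>n. ennreal e * ennreal ((1/2) ^ Suc n))"
    using \<open>0 < e\<close> by (subst suminf_add[symmetric])
      (auto simp del: ennreal_suminf_cmult simp add: ennreal_mult[symmetric])
  also have "\<dots> = (\<Sum>n. ?H (A n)) + e"
    unfolding ennreal_suminf_cmult
    by (subst suminf_ennreal_eq[OF zero_le_power power_half_series]) auto
  finally show "?H (\<Union>n. A n) \<le> (\<Sum>n. ?H (A n)) + e" .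
qed

lemma hausdorff_premeasure_le_outer:
  "0 < \<delta> \<Longrightarrow> hausdorff_premeasure d \<delta> A \<le> hausdorff_outer_measure d A"
  unfolding hausdorff_outer_measure_def by (auto intro: SUP_upper)

lemma outer_measure_space_hausdorff: "outer_measure_space UNIV (hausdorff_outer_measure d)"
  unfolding outer_measure_space_def positive_def increasing_def countably_subadditive_def
proof safe
  show "hausdorff_outer_measure d {} = 0"
    by (simp add: hausdorff_outer_measure_def hausdorff_premeasure_empty)
next
  fix A B :: "real set" assume "A \<subseteq> B"
  then show "hausdorff_outer_measure d A \<le> hausdorff_outer_measure d B"
    unfolding hausdorff_outer_measure_def by (intro SUP_mono') (auto intro: hausdorff_premeasure_antimono)
next
  fix A :: "nat \<Rightarrow> real set"
  show "hausdorff_outer_measure d (\<Union> (range A)) \<le> (\<Sum>i. hausdorff_outer_measure d (A i))"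
    unfolding hausdorff_outer_measure_def[of d "\<Union> (range A)"]
  proof (rule SUP_least)
    fix \<delta> :: real assume "\<delta> \<in> {0<..}"
    then have "(\<Sum>i. hausdorff_premeasure d \<delta> (A i)) \<le> (\<Sum>i. hausdorff_outer_measure d (A i))"
      by (intro suminf_le) (auto intro: hausdorff_premeasure_le_outer)
    then show "hausdorff_premeasure d \<delta> (\<Union> (range A)) \<le> (\<Sum>i. hausdorff_outer_measure d (A i))"
      using hausdorff_premeasure_UN_le order_trans by blast
  qed
qed

text \<open>A set of diameter at most \<open>\<delta>\<close> that meets both \<open>{..a}\<close> and \<open>{a<..}\<close> lies in \<open>{a - \<delta>..a + \<delta>}\<close>.\<close>
lemma hausdorff_premeasure_split:
  assumes "0 < d" "0 < \<delta>"
  shows "hausdorff_premeasure d \<delta> (X \<inter> {..a}) + hausdorff_premeasure d \<delta> (X \<inter> {a<..})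
    \<le> hausdorff_premeasure d \<delta> X + 2 * ennreal (\<delta> powr d)"
proof -
  have "hausdorff_premeasure d \<delta> (X \<inter> {..a}) + hausdorff_premeasure d \<delta> (X \<inter> {a<..})
    \<le> (\<Sum>i. hausdorff_gauge d (U i)) + 2 * ennreal (\<delta> powr d)" if U: "U \<in> hausdorff_covers \<delta> X" for U
  proof -
    define V where "V = (\<lambda>i. case i of 0 \<Rightarrow> {a - \<delta>..a} | Suc j \<Rightarrow> if U j \<subseteq> {..a} then U j else {})"
    define W where "W = (\<lambda>i. case i of 0 \<Rightarrow> {a..a + \<delta>} | Suc j \<Rightarrow> if U j \<subseteq> {..a} then {} else
       if U j \<subseteq> {a<..} then U j else {})"
    have bd: "bounded (U i)" "diameter (U i) \<le> \<delta>" for i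
      using U by (auto simp: hausdorff_covers_def)
    have dist: "\<bar>x - y\<bar> \<le> \<delta>" if "x \<in> U i" "y \<in> U i" for x y i
      using diameter_bounded_bound[OF bd(1) that] bd(2)[of i] by (auto simp: dist_real_def)
    have cov: "\<exists>i. x \<in> U i" if "x \<in> X" for x
      using U that by (auto simp: hausdorff_covers_def)
    have "x \<in> (\<Union>i. V i)" if x: "x \<in> X" "x \<le> a" for x
    proof -
      obtain i where i: "x \<in> U i" using cov x by blast
      show ?thesis
      proof (cases "U i \<subseteq> {..a}")
        case True
        then show ?thesis using i by (auto simp: V_def intro!: exI[of _ "Suc i"])
      next
        case False
        then obtain y where "y \<in> U i" "a < y" by force
        with dist[OF i] x have "x \<in> V 0" by (force simp: V_def)
        then show ?thesis by blast
      qed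
    qed
    moreover have "x \<in> (\<Union>i. W i)" if x: "x \<in> X" "a < x" for x
    proof -
      obtain i where i: "x \<in> U i" using cov x by blast
      show ?thesis
      proof (cases "U i \<subseteq> {a<..}")
        case True
        then show ?thesis using i x by (force simp: W_def intro!: exI[of _ "Suc i"])
      next
        case False
        then obtain y where "y \<in> U i" "y \<le> a" by force
        with dist[OF i] x have "x \<in> W 0" by (force simp: W_def)
        then show ?thesis by blast
      qed
    qed
    ultimately have "V \<in> hausdorff_covers \<delta> (X \<inter> {..a})" "W \<in> hausdorff_covers \<delta> (X \<inter> {a<..})"
      using bd assms by (auto simp: hausdorff_covers_def V_def W_def split: nat.split)
    then have "hausdorff_premeasure d \<delta> (X \<inter> {..a}) + hausdorff_premeasure d \<delta> (X \<inter> {a<..})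
      \<le> (\<Sum>i. hausdorff_gauge d (V i)) + (\<Sum>i. hausdorff_gauge d (W i))"
      by (intro add_mono hausdorff_premeasure_le)
    also have "\<dots> = (\<Sum>i. hausdorff_gauge d (V i) + hausdorff_gauge d (W i))"
      by (rule suminf_add) auto
    also have "\<dots> = (hausdorff_gauge d (V 0) + hausdorff_gauge d (W 0))
        + (\<Sum>i. hausdorff_gauge d (V (Suc i)) + hausdorff_gauge d (W (Suc i)))"
      using suminf_offset[of "\<lambda>i. hausdorff_gauge d (V i) + hausdorff_gauge d (W i)" 1] by simp
    also have "hausdorff_gauge d (V 0) + hausdorff_gauge d (W 0) = 2 * ennreal (\<delta> powr d)"
      using assms by (simp add: V_def W_def hausdorff_gauge_def mult_2)
    also have "(\<Sum>i. hausdorff_gauge d (V (Suc i)) + hausdorff_gauge d (W (Suc i)))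
        \<le> (\<Sum>i. hausdorff_gauge d (U i))"
      by (intro suminf_le) (auto simp: V_def W_def hausdorff_gauge_def)
    finally show ?thesis by (simp add: add.commute add_left_mono)
  qed
  then have "hausdorff_premeasure d \<delta> (X \<inter> {..a}) + hausdorff_premeasure d \<delta> (X \<inter> {a<..})
      - 2 * ennreal (\<delta> powr d) \<le> hausdorff_premeasure d \<delta> X"
    unfolding hausdorff_premeasure_def[of d \<delta> X]
    by (intro INF_greatest) (simp add: ennreal_minus_le_iff add.commute ennreal_mult_eq_top_iff)
  then show ?thesis
    by (simp add: ennreal_minus_le_iff add.commute)
qed

lemma tendsto_hausdorff_premeasure:
  "((\<lambda>\<delta>. hausdorff_premeasure d \<delta> A) \<longlongrightarrow> hausdorff_outer_measure d A) (at_right 0)"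
proof (rule order_tendstoI)
  fix y assume "y < hausdorff_outer_measure d A"
  then obtain \<delta> where \<delta>: "0 < \<delta>" "y < hausdorff_premeasure d \<delta> A"
    by (auto simp: hausdorff_outer_measure_def less_SUP_iff)
  have "\<forall>\<^sub>F \<epsilon> in at_right 0. \<epsilon> \<in> {0<..<\<delta>}"
    using \<delta> by (intro eventually_at_right_real)
  then show "\<forall>\<^sub>F \<epsilon> in at_right 0. y < hausdorff_premeasure d \<epsilon> A"
    by eventually_elim (use \<delta> hausdorff_premeasure_antimono[of _ \<delta> A A d] in \<open>force intro: less_le_trans\<close>)
next
  fix y assume "hausdorff_outer_measure d A < y"
  then show "\<forall>\<^sub>F \<epsilon> in at_right 0. hausdorff_premeasure d \<epsilon> A < y"
    using hausdorff_premeasure_le_outer[of _ d A]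
    by (auto simp: eventually_at_filter intro!: always_eventually intro: le_less_trans)
qed

lemma hausdorff_outer_measure_split:
  assumes "0 < d"
  shows "hausdorff_outer_measure d (X \<inter> {..a}) + hausdorff_outer_measure d (X \<inter> {a<..})
    \<le> hausdorff_outer_measure d X"
proof -
  have "((\<lambda>\<delta>. \<delta> powr d) \<longlongrightarrow> 0 powr d) (at_right 0)"
    using assms by (intro tendsto_powr2 tendsto_intros) (auto simp: eventually_at_filter)
  then have "((\<lambda>\<delta>. ennreal (\<delta> powr d)) \<longlongrightarrow> 0) (at_right 0)"
    using tendsto_ennrealI by fastforce
  then have "((\<lambda>\<delta>. 2 * ennreal (\<delta> powr d)) \<longlongrightarrow> 2 * 0) (at_right 0)"
    by (intro ennreal_tendsto_cmult) auto
  then have "((\<lambda>\<delta>. hausdorff_premeasure d \<delta> X + 2 * ennreal (\<delta> powr d)) \<longlongrightarrow>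
      hausdorff_outer_measure d X + 2 * 0) (at_right 0)"
    by (intro tendsto_add tendsto_hausdorff_premeasure)
  moreover have "((\<lambda>\<delta>. hausdorff_premeasure d \<delta> (X \<inter> {..a}) + hausdorff_premeasure d \<delta> (X \<inter> {a<..})) \<longlongrightarrow>
      hausdorff_outer_measure d (X \<inter> {..a}) + hausdorff_outer_measure d (X \<inter> {a<..})) (at_right 0)"
    by (intro tendsto_add tendsto_hausdorff_premeasure)
  ultimately show ?thesis
    using tendsto_le[of "at_right (0::real)"] hausdorff_premeasure_split[OF assms]
    by (force simp: eventually_at_filter)
qed

text \<open>Normalization at \<open>d = 0\<close>: counting measure.\<close>
lemma hausdorff_outer_measure_0:
  "hausdorff_outer_measure 0 A = emeasure (count_space UNIV) A"
proof (rule antisym)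
  show "hausdorff_outer_measure 0 A \<le> emeasure (count_space UNIV) A"
  proof (cases "finite A")
    case True
    then obtain h where h: "bij_betw h {0..<card A} A"
      using ex_bij_betw_nat_finite by blast
    define U where "U = (\<lambda>i. if i < card A then {h i} else {})"
    have "(\<Sum>i. hausdorff_gauge 0 (U i)) = (\<Sum>i<card A. hausdorff_gauge 0 (U i))"
      by (rule suminf_finite) (auto simp: U_def hausdorff_gauge_def)
    also have "\<dots> = of_nat (card A)"
      by (simp add: U_def hausdorff_gauge_def)
    finally have sum: "(\<Sum>i. hausdorff_gauge 0 (U i)) = of_nat (card A)" .
    have "A \<subseteq> (\<Union>i. U i)"
    proof
      fix x assume "x \<in> A"
      then obtain i where "i < card A" "x = h i"
        using h by (metis atLeastLessThan_iff bij_betw_iff_bijections)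
      then show "x \<in> (\<Union>i. U i)" by (auto simp: U_def intro!: exI[of _ i])
    qed
    then have "U \<in> hausdorff_covers \<delta> A" if "0 < \<delta>" for \<delta>
      using that by (auto simp: hausdorff_covers_def U_def)
    from hausdorff_premeasure_le[OF this, of _ 0] show ?thesis
      unfolding hausdorff_outer_measure_def using True sum by (auto intro!: SUP_least)
  qed simp
next
  have fin: "of_nat (card F) \<le> hausdorff_outer_measure 0 A" if F: "finite F" "F \<subseteq> A" for F
  proof -
    obtain \<delta> where \<delta>: "0 < \<delta>" "\<And>x y. x \<in> F \<Longrightarrow> y \<in> F \<Longrightarrow> x \<noteq> y \<Longrightarrow> \<delta> < dist x y"
    proof -
      define S where "S = insert 1 {dist x y |x y. x \<in> F \<and> y \<in> F \<and> x \<noteq> y}"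
      have "{dist x y |x y. x \<in> F \<and> y \<in> F \<and> x \<noteq> y} \<subseteq> (\<lambda>(x, y). dist x y) ` (F \<times> F)" by auto
      then have S: "finite S" "S \<noteq> {}"
        using F finite_subset by (fastforce simp: S_def)+
      then have "0 < Min S" by (subst Min_gr_iff) (auto simp: S_def)
      moreover have "Min S \<le> dist x y" if "x \<in> F" "y \<in> F" "x \<noteq> y" for x y
        using S that by (intro Min_le) (auto simp: S_def)
      ultimately show ?thesis by (intro that[of "Min S / 2"]) force+
    qed
    have "of_nat (card F) \<le> (\<Sum>i. hausdorff_gauge 0 (U i))" if U: "U \<in> hausdorff_covers \<delta> A" for U
    proof -
      have "\<exists>i. x \<in> U i" if "x \<in> F" for x
        using U F that by (auto simp: hausdorff_covers_def)
      then obtain k where k: "\<And>x. x \<in> F \<Longrightarrow> x \<in> U (k x)" by metis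
      have "inj_on k F"
      proof (rule inj_onI, rule ccontr)
        fix x y assume xy: "x \<in> F" "y \<in> F" "k x = k y" "x \<noteq> y"
        have "dist x y \<le> diameter (U (k x))"
          using U k[of x] k[of y] xy by (intro diameter_bounded_bound) (auto simp: hausdorff_covers_def)
        also have "\<dots> \<le> \<delta>" using U by (auto simp: hausdorff_covers_def)
        finally show False using \<delta>(2) xy by force
      qed
      then have "of_nat (card F) = (\<Sum>i\<in>k ` F. 1::ennreal)"
        by (simp add: card_image)
      also have "\<dots> = (\<Sum>i\<in>k ` F. hausdorff_gauge 0 (U i))"
        using k by (intro sum.cong) (auto simp: hausdorff_gauge_def)
      also have "\<dots> \<le> (\<Sum>i. hausdorff_gauge 0 (U i))"
        using F by (intro sum_le_suminf) auto
      finally show ?thesis .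
    qed
    then have "of_nat (card F) \<le> hausdorff_premeasure 0 \<delta> A"
      unfolding hausdorff_premeasure_def by (intro INF_greatest)
    also have "\<dots> \<le> hausdorff_outer_measure 0 A"
      using \<delta>(1) by (rule hausdorff_premeasure_le_outer)
    finally show ?thesis .
  qed
  show "emeasure (count_space UNIV) A \<le> hausdorff_outer_measure 0 A"
  proof (cases "finite A")
    case True
    then show ?thesis using fin[of A] by simp
  next
    case False
    have "of_nat n \<le> hausdorff_outer_measure 0 A" for n :: nat
      using infinite_arbitrarily_large[OF False, of n] fin by metis
    then have "hausdorff_outer_measure 0 A = top"
      by (metis ennreal_Ex_less_of_nat less_le_not_le not_le top.not_eq_extremum)
    then show ?thesis by simp
  qed
qed

lemma sets_hausdorff_measure [simp, measurable_cong]: "sets (hausdorff_measure d) = sets borel"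
  and space_hausdorff_measure [simp]: "space (hausdorff_measure d) = UNIV"
  using sets.sigma_sets_eq[of "borel :: real measure"]
  by (simp_all add: hausdorff_measure_def space_measure_of_conv)

theorem emeasure_hausdorff_measure:
  assumes "0 \<le> d" "A \<in> sets borel"
  shows "emeasure (hausdorff_measure d) A = hausdorff_outer_measure d A"
proof -
  let ?O = "hausdorff_outer_measure d"
  let ?L = "lambda_system UNIV UNIV ?O"
  interpret P: sigma_algebra "UNIV :: real set" "UNIV :: real set set"
    using sigma_algebra_Pow[of UNIV] by simp
  have ms: "measure_space UNIV ?L ?O"
    by (rule P.caratheodory_lemma[OF outer_measure_space_hausdorff])
  then interpret L: sigma_algebra UNIV ?L by (simp add: measure_space_def)
  have "{..a} \<in> ?L" for a
  proof -
    have "?O ({..a} \<inter> X) + ?O ((UNIV - {..a}) \<inter> X) = ?O X" for X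
    proof -
      have eq: "{..a} \<inter> X = X \<inter> {..a}" "(UNIV - {..a}) \<inter> X = X \<inter> {a<..}" by auto
      show ?thesis
      proof (cases "d = 0")
        case True
        have "emeasure (count_space UNIV) (X \<inter> {..a}) + emeasure (count_space UNIV) (X \<inter> {a<..}) =
            emeasure (count_space UNIV) X"
          by (subst plus_emeasure) (auto intro!: arg_cong[where f="emeasure (count_space UNIV)"])
        then show ?thesis unfolding eq True hausdorff_outer_measure_0 .
      next
        case False
        have "subadditive UNIV ?O"
          using outer_measure_space_hausdorff[of d] P.countably_subadditive_subadditive
          by (auto simp: outer_measure_space_def)
        from subadditiveD[OF this, of "X \<inter> {..a}" "X \<inter> {a<..}"]
        have "?O (X \<inter> {..a} \<union> X \<inter> {a<..}) \<le> ?O (X \<inter> {..a}) + ?O (X \<inter> {a<..})"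
          by fastforce
        also have "X \<inter> {..a} \<union> X \<inter> {a<..} = X" by auto
        finally show ?thesis
          using hausdorff_outer_measure_split[of d X a] False assms unfolding eq by (intro antisym) auto
      qed
    qed
    then show ?thesis by (simp add: lambda_system_def)
  qed
  then have "sigma_sets UNIV (range (\<lambda>a. {..a})) \<subseteq> ?L"
    by (intro L.sigma_sets_subset) auto
  then have "sets (borel :: real measure) \<subseteq> ?L"
    by (subst borel_eq_atMost) simp
  then have "measure_space UNIV (sets (borel :: real measure)) ?O"
    by (intro measure_down[OF ms]) (use sets.sigma_algebra_axioms[of "borel :: real measure"] in auto)
  then show ?thesis
    unfolding hausdorff_measure_def using assms(2) sets.sigma_sets_eq[of "borel :: real measure"]
    by (intro emeasure_measure_of_sigma) (auto simp: measure_space_def)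
qed

text \<open>Normalization at \<open>d = 1\<close>: Lebesgue measure.\<close>
lemma hausdorff_outer_measure_1_ge:
  assumes "A \<in> sets borel"
  shows "emeasure lborel A \<le> hausdorff_outer_measure 1 A"
proof -
  have "emeasure lborel A \<le> (\<Sum>i. hausdorff_gauge 1 (U i))" if U: "U \<in> hausdorff_covers 1 A" for U
  proof -
    have bd: "bounded (U i)" for i using U by (auto simp: hausdorff_covers_def)
    define V where "V i = (if U i = {} then {} else {Inf (U i)..Inf (U i) + diameter (U i)})" for i
    have "U i \<subseteq> V i" for i
    proof (cases "U i = {}")
      case False
      have "x \<in> V i" if x: "x \<in> U i" for x
      proof -
        have "x - diameter (U i) \<le> Inf (U i)"
        proof (rule cInf_greatest[OF False])
          fix y assume "y \<in> U i"
          from diameter_bounded_bound[OF bd x this] show "x - diameter (U i) \<le> y"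
            by (auto simp: dist_real_def)
        qed
        moreover have "Inf (U i) \<le> x"
          using x bd by (intro cInf_lower bounded_imp_bdd_below)
        ultimately show ?thesis using False by (auto simp: V_def)
      qed
      then show ?thesis by blast
    qed simp
    then have "A \<subseteq> (\<Union>i. V i)" using U by (fastforce simp: hausdorff_covers_def)
    then have "emeasure lborel A \<le> emeasure lborel (\<Union>i. V i)"
      by (intro emeasure_mono) (auto simp: V_def)
    also have "\<dots> \<le> (\<Sum>i. emeasure lborel (V i))"
      by (intro emeasure_subadditive_countably) (auto simp: V_def)
    also have "\<dots> = (\<Sum>i. hausdorff_gauge 1 (U i))"
      using diameter_ge_0[OF bd] by (intro suminf_cong) (auto simp: V_def hausdorff_gauge_def)
    finally show ?thesis .
  qed
  then have "emeasure lborel A \<le> hausdorff_premeasure 1 1 A"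
    unfolding hausdorff_premeasure_def by (intro INF_greatest)
  also have "\<dots> \<le> hausdorff_outer_measure 1 A"
    by (rule hausdorff_premeasure_le_outer) simp
  finally show ?thesis .
qed

lemma hausdorff_outer_measure_1_le:
  assumes "a \<le> b"
  shows "hausdorff_outer_measure 1 {a..b} \<le> ennreal (b - a)"
  unfolding hausdorff_outer_measure_def
proof (rule SUP_least)
  fix \<delta> :: real assume "\<delta> \<in> {0<..}"
  then have "0 < \<delta>" by simp
  obtain n :: nat where n: "0 < n" "(b - a) / n \<le> \<delta>"
  proof -
    obtain n :: nat where n: "(b - a) / \<delta> < n" using reals_Archimedean2 by blast
    moreover have "0 \<le> (b - a) / \<delta>" using assms \<open>0 < \<delta>\<close> by simp
    ultimately have "0 < n" by linarith
    then show ?thesis using n \<open>0 < \<delta>\<close> by (intro that[of n]) (auto simp: field_simps)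
  qed
  define h where "h = (b - a) / n"
  have h: "0 \<le> h" "n * h = b - a" using assms n by (auto simp: h_def)
  define U where "U i = (if i < n then {a + i * h..a + (i + 1) * h} else {})" for i :: nat
  have dU: "diameter (U i) = (if i < n then h else 0)" for i
    using h by (auto simp: U_def algebra_simps)
  have "x \<in> (\<Union>i. U i)" if x: "a \<le> x" "x \<le> b" for x
  proof (cases "x = b \<or> h = 0")
    case True
    then have "x = b" using h x by auto
    then have "x \<in> U (n - 1)" using h n by (auto simp: U_def of_nat_diff algebra_simps)
    then show ?thesis by blast
  next
    case False
    then have "0 < h" "x < b" using h x by auto
    define i where "i = nat \<lfloor>(x - a) / h\<rfloor>"
    have fl: "real i \<le> (x - a) / h" "(x - a) / h < i + 1"
      using x \<open>0 < h\<close> by (simp_all add: i_def, linarith)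
    have "(x - a) / h < n" using h \<open>0 < h\<close> \<open>x < b\<close> by (simp add: field_simps)
    with fl have "i < n" by linarith
    moreover have "i * h \<le> x - a" "x - a \<le> (i + 1) * h"
      using fl \<open>0 < h\<close> by (auto simp: field_simps)
    ultimately have "x \<in> U i" by (auto simp: U_def algebra_simps)
    then show ?thesis by blast
  qed
  then have "U \<in> hausdorff_covers \<delta> {a..b}"
    using n(2) \<open>0 < \<delta>\<close> by (auto simp: hausdorff_covers_def dU h_def) (auto simp: U_def)
  then have "hausdorff_premeasure 1 \<delta> {a..b} \<le> (\<Sum>i. hausdorff_gauge 1 (U i))"
    by (rule hausdorff_premeasure_le)
  also have "\<dots> = (\<Sum>i<n. hausdorff_gauge 1 (U i))"
    by (rule suminf_finite) (auto simp: U_def hausdorff_gauge_def)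
  also have "\<dots> \<le> (\<Sum>i<n. ennreal h)"
    using h by (intro sum_mono) (auto simp: hausdorff_gauge_def dU)
  also have "\<dots> = ennreal (b - a)"
    using h by (simp flip: ennreal_of_nat_eq_real_of_nat ennreal_mult' add: h(2)[symmetric] ennreal_mult)
  finally show "hausdorff_premeasure 1 \<delta> {a..b} \<le> ennreal (b - a)" .
qed

theorem hausdorff_measure_1: "hausdorff_measure 1 = lborel"
proof (rule lborel_eqI[symmetric])
  fix l u :: real assume le: "\<And>b. b \<in> Basis \<Longrightarrow> l \<bullet> b \<le> u \<bullet> b"
  then have "l \<le> u" by simp
  have "hausdorff_outer_measure 1 (box l u) \<le> hausdorff_outer_measure 1 {l..u}"
    using outer_measure_space_hausdorff[of 1]
    by (simp add: outer_measure_space_def increasing_def greaterThanLessThan_subseteq_atLeastAtMost_iff)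
  also have "\<dots> \<le> ennreal (u - l)" by (rule hausdorff_outer_measure_1_le[OF \<open>l \<le> u\<close>])
  finally have "hausdorff_outer_measure 1 (box l u) \<le> ennreal (u - l)" .
  moreover have "ennreal (u - l) \<le> hausdorff_outer_measure 1 (box l u)"
    using hausdorff_outer_measure_1_ge[of "box l u"] \<open>l \<le> u\<close> by (simp add: box_real)
  ultimately show "emeasure (hausdorff_measure 1) (box l u) = (\<Prod>b\<in>Basis. (u - l) \<bullet> b)"
    by (simp add: emeasure_hausdorff_measure)
qed simp

theorem hausdorff_measure_0:
  "A \<in> sets borel \<Longrightarrow> emeasure (hausdorff_measure 0) A = emeasure (count_space UNIV) A"
  by (simp add: emeasure_hausdorff_measure hausdorff_outer_measure_0)

end

theory Submission
  imports Defs
begin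

text \<open>
  Write \<open>D\<^sub>n\<close> and \<open>D\<close> for the supports of \<open>f\<^sub>n\<close> and of the limit \<open>g\<close>. As the \<open>f\<^sub>n\<close> are nonnegative and
  increase, the sets \<open>D\<^sub>n\<close> increase and their union is \<open>D\<close>. Hausdorff dimension is monotone and
  countably stable, hence \<open>dim D\<^sub>n \<le> dim D\<close>, and \<open>dim D\<^sub>n\<close> eventually exceeds every number
  below \<open>d = dim D\<close>. The values of the integrals never exceed the claimed limit: either
  \<open>dim D\<^sub>n < d\<close>, or both integrals are taken with respect to \<open>\<mu>\<^sup>d\<close> and \<open>f\<^sub>n \<le> g\<close>. Hence only the lower
  neighbourhoods of the limit need attention. There are two cases.

  If \<open>dim D\<^sub>n = d\<close> for some \<open>n\<close>, then the same holds from there on, all these integrals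
  are taken with respect to the single measure \<open>\<mu>\<^sup>d\<close>, and their second components increase to that of
  the limit by the monotone convergence theorem.

  Otherwise \<open>dim D\<^sub>n < d\<close> for all \<open>n\<close>. Every lower neighbourhood of \<open>(d, m)\<close> with \<open>m > 0\<close> that is
  given by a point \<open>(d, m')\<close> would then miss the whole sequence, so it is essential that \<open>m = 0\<close>:
  each \<open>D\<^sub>n\<close> is \<open>\<mu>\<^sup>d\<close>-null because its dimension is below \<open>d\<close>, and therefore so is \<open>D\<close>. The lower
  neighbourhoods of \<open>(d, 0)\<close> are all given by points with first component below \<open>d\<close>.
\<close>

section \<open>Convergence in an order topology\<close>

text \<open>The property of eventually containing the sequence passes to finite intersections and to unions.\<close>
lemma limitin_topology_generated_byI:
  assumes l: "l \<in> \<Union>S"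
    and S: "\<And>U. U \<in> S \<Longrightarrow> l \<in> U \<Longrightarrow> \<forall>\<^sub>F n in F. x n \<in> U"
  shows "limitin (topology_generated_by S) x l F"
proof -
  have "l \<in> U \<Longrightarrow> \<forall>\<^sub>F n in F. x n \<in> U" if "generate_topology_on S U" for U
    using that
  proof induction
    case (Int a b)
    then show ?case by (auto intro: eventually_conj)
  next
    case (UN \<U>)
    then obtain k where "k \<in> \<U>" "l \<in> k" "\<forall>\<^sub>F n in F. x n \<in> k" by blast
    then show ?case by (auto elim: eventually_mono)
  qed (auto intro: S)
  then show ?thesis
    using l by (auto simp: limitin_def openin_topology_generated_by_iff)
qed

lemma lex_le_trans: "lex_le p q \<Longrightarrow> lex_le q r \<Longrightarrow> lex_le p r"
  by (auto simp: lex_le_def)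

lemma lex_le_antisym: "lex_le p q \<Longrightarrow> lex_le q p \<Longrightarrow> p = q"
  by (auto simp: lex_le_def prod_eq_iff)

text \<open>For a sequence that stays below its limit the upper rays are dealt with by transitivity.\<close>
lemma limitin_hausdorff_value_topology_belowI:
  assumes p: "p \<in> {0..1} \<times> {0..}"
    and x: "\<And>n. x n \<in> {0..1} \<times> {0..}" "\<And>n. lex_le (x n) p"
    and lower: "\<And>a. a \<in> {0..1} \<times> {0..} \<Longrightarrow> lex_le a p \<Longrightarrow> a \<noteq> p \<Longrightarrow>
      \<forall>\<^sub>F n in F. lex_le a (x n) \<and> x n \<noteq> a"
  shows "limitin hausdorff_value_topology x p F"
  unfolding hausdorff_value_topology_def order_topology_on_def
proof (rule limitin_topology_generated_byI)
  fix U :: "(real \<times> ereal) set"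
  let ?C = "{0..1} \<times> {0..} :: (real \<times> ereal) set"
  assume "U \<in> {?C} \<union> {{y \<in> ?C. lex_le y a \<and> y \<noteq> a} |a. a \<in> ?C}
      \<union> {{y \<in> ?C. lex_le a y \<and> y \<noteq> a} |a. a \<in> ?C}"
    and "p \<in> U"
  then consider "U = ?C"
    | a where "U = {y \<in> ?C. lex_le y a \<and> y \<noteq> a}" "lex_le p a" "p \<noteq> a"
    | a where "a \<in> ?C" "U = {y \<in> ?C. lex_le a y \<and> y \<noteq> a}" "lex_le a p" "a \<noteq> p"
    by blast
  then show "\<forall>\<^sub>F n in F. x n \<in> U"
  proof cases
    case 1
    then show ?thesis using x by simp
  next
    case 2
    then have "x n \<in> U" for n
      using x lex_le_trans lex_le_antisym by blast
    then show ?thesis by simp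
  next
    case 3
    then show ?thesis using x lower by simp
  qed
qed (use p in auto)


section \<open>Hausdorff dimension\<close>

lemma hausdorff_outer_measure_mono:
  "A \<subseteq> B \<Longrightarrow> hausdorff_outer_measure d A \<le> hausdorff_outer_measure d B"
  using outer_measure_space_hausdorff[of d] by (simp add: outer_measure_space_def increasing_def)

lemma hausdorff_outer_measure_UN_eq_0:
  assumes "\<And>n :: nat. hausdorff_outer_measure d (A n) = 0"
  shows "hausdorff_outer_measure d (\<Union>n. A n) = 0"
proof -
  have "hausdorff_outer_measure d (\<Union>n. A n) \<le> (\<Sum>n. hausdorff_outer_measure d (A n))"
    unfolding hausdorff_outer_measure_def[of d "\<Union>n. A n"]
  proof (rule SUP_least)
    fix \<delta> :: real assume "\<delta> \<in> {0<..}"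
    then have "(\<Sum>n. hausdorff_premeasure d \<delta> (A n)) \<le> (\<Sum>n. hausdorff_outer_measure d (A n))"
      by (intro suminf_le) (auto intro: hausdorff_premeasure_le_outer)
    then show "hausdorff_premeasure d \<delta> (\<Union>n. A n) \<le> (\<Sum>n. hausdorff_outer_measure d (A n))"
      using hausdorff_premeasure_UN_le order_trans by blast
  qed
  then show ?thesis using assms by simp
qed

lemma hausdorff_gauge_raise_exponent:
  assumes "0 \<le> s" "s < t" "bounded U" "diameter U \<le> \<delta>"
  shows "hausdorff_gauge t U \<le> ennreal (\<delta> powr (t - s)) * hausdorff_gauge s U"
proof -
  have diam: "0 \<le> diameter U" using assms by (simp add: diameter_ge_0)
  have "diameter U powr t = diameter U powr (t - s) * diameter U powr s"
    by (simp flip: powr_add)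
  also have "\<dots> \<le> \<delta> powr (t - s) * diameter U powr s"
    using diam assms by (intro mult_right_mono powr_mono2) auto
  finally have "ennreal (diameter U powr t) \<le> ennreal (\<delta> powr (t - s)) * ennreal (diameter U powr s)"
    by (simp flip: ennreal_mult)
  moreover have "diameter U powr t \<le> \<delta> powr t"
    using diam assms by (intro powr_mono2) auto
  ultimately show ?thesis
    using assms by (auto simp: hausdorff_gauge_def)
qed

text \<open>
  Raising the exponent from \<open>s\<close> to \<open>t\<close> gains a factor \<open>\<delta> powr (t - s)\<close> on sets of diameter at most
  \<open>\<delta>\<close>, and this factor tends to \<open>0\<close> with \<open>\<delta>\<close>.
\<close>
lemma hausdorff_outer_measure_eq_0_above_finite:
  assumes "0 \<le> s" "s < t" and fin: "hausdorff_outer_measure s A < top"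
  shows "hausdorff_outer_measure t A = 0"
proof -
  obtain y where y: "hausdorff_outer_measure s A < y" "y < top"
    using dense[OF fin] by blast
  then obtain M where M: "0 \<le> M" "hausdorff_outer_measure s A < ennreal M"
    by (cases y) auto
  have bound: "hausdorff_premeasure t \<delta> A \<le> ennreal (\<delta> powr (t - s) * M)" if "0 < \<delta>" for \<delta>
  proof -
    have "hausdorff_premeasure s \<delta> A < ennreal M"
      using hausdorff_premeasure_le_outer[OF that] M(2) by (rule le_less_trans)
    then obtain U where U: "U \<in> hausdorff_covers \<delta> A" "(\<Sum>i. hausdorff_gauge s (U i)) < ennreal M"
      unfolding hausdorff_premeasure_def by (auto simp: INF_less_iff)
    have "hausdorff_premeasure t \<delta> A \<le> (\<Sum>i. hausdorff_gauge t (U i))"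
      using U(1) by (rule hausdorff_premeasure_le)
    also have "\<dots> \<le> (\<Sum>i. ennreal (\<delta> powr (t - s)) * hausdorff_gauge s (U i))"
      using U(1) assms
      by (intro suminf_le hausdorff_gauge_raise_exponent) (auto simp: hausdorff_covers_def)
    also have "\<dots> = ennreal (\<delta> powr (t - s)) * (\<Sum>i. hausdorff_gauge s (U i))"
      by simp
    also have "\<dots> \<le> ennreal (\<delta> powr (t - s)) * ennreal M"
      using U(2) by (intro mult_left_mono) auto
    finally show ?thesis
      using M(1) by (simp add: ennreal_mult)
  qed
  have "((\<lambda>\<delta>. \<delta> powr (t - s) * M) \<longlongrightarrow> 0 powr (t - s) * M) (at_right 0)"
    using assms by (intro tendsto_powr2 tendsto_intros) (auto simp: eventually_at_filter)
  then have "((\<lambda>\<delta>. ennreal (\<delta> powr (t - s) * M)) \<longlongrightarrow> 0) (at_right 0)"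
    using tendsto_ennrealI by fastforce
  moreover have "\<forall>\<^sub>F \<delta> in at_right 0. hausdorff_premeasure t \<delta> A \<le> ennreal (\<delta> powr (t - s) * M)"
    using bound by (simp add: eventually_at_filter)
  ultimately have "hausdorff_outer_measure t A \<le> 0"
    using tendsto_hausdorff_premeasure by (intro tendsto_le) auto
  then show ?thesis by simp
qed

lemma hausdorff_outer_measure_eq_0_above_1:
  assumes "1 < t"
  shows "hausdorff_outer_measure t A = 0"
proof -
  have "hausdorff_outer_measure t {- real n..real n} = 0" for n
  proof (rule hausdorff_outer_measure_eq_0_above_finite[OF _ assms])
    have "hausdorff_outer_measure 1 {- real n..real n} \<le> ennreal (real n - - real n)"
      by (rule hausdorff_outer_measure_1_le) simp
    also have "\<dots> < top" by simp
    finally show "hausdorff_outer_measure 1 {- real n..real n} < top" .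
  qed simp
  then have "hausdorff_outer_measure t (\<Union>n. {- real n..real n}) = 0"
    by (rule hausdorff_outer_measure_UN_eq_0)
  moreover have "A \<subseteq> (\<Union>n. {- real n..real n})"
  proof
    fix x
    obtain n :: nat where "\<bar>x\<bar> \<le> real n" using real_arch_simple by blast
    then show "x \<in> (\<Union>n. {- real n..real n})" by (auto intro!: exI[of _ n])
  qed
  ultimately show ?thesis
    using hausdorff_outer_measure_mono[of A _ t] by (metis le_zero_eq)
qed

lemma hausdorff_dim_le:
  "0 \<le> s \<Longrightarrow> hausdorff_outer_measure s A = 0 \<Longrightarrow> hausdorff_dim A \<le> s"
  unfolding hausdorff_dim_def by (rule cInf_lower) (auto intro: bdd_belowI[of _ 0])

lemma hausdorff_null_exponents_nonempty: "{d. 0 \<le> d \<and> hausdorff_outer_measure d A = 0} \<noteq> {}"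
proof -
  have "2 \<in> {d. 0 \<le> d \<and> hausdorff_outer_measure d A = 0}"
    using hausdorff_outer_measure_eq_0_above_1[of 2 A] by simp
  then show ?thesis by blast
qed

lemma hausdorff_dim_nonneg: "0 \<le> hausdorff_dim A"
  unfolding hausdorff_dim_def
  using hausdorff_null_exponents_nonempty by (rule cInf_greatest) simp

lemma hausdorff_dim_le_1: "hausdorff_dim A \<le> 1"
  by (rule dense_ge) (auto intro: hausdorff_dim_le hausdorff_outer_measure_eq_0_above_1)

text \<open>
  The infimum in the definition of the dimension need not be attained, but vanishing of the measure
  passes from any exponent to all larger ones.
\<close>
lemma hausdorff_outer_measure_eq_0_above_dim:
  assumes "hausdorff_dim A < s"
  shows "hausdorff_outer_measure s A = 0"
proof -
  obtain d where "0 \<le> d" "hausdorff_outer_measure d A = 0" "d < s"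
    using cInf_lessD[OF hausdorff_null_exponents_nonempty assms[unfolded hausdorff_dim_def]] by blast
  then show ?thesis
    by (intro hausdorff_outer_measure_eq_0_above_finite[of d]) auto
qed

lemma hausdorff_dim_mono:
  assumes "A \<subseteq> B"
  shows "hausdorff_dim A \<le> hausdorff_dim B"
proof (rule dense_ge)
  fix s assume s: "hausdorff_dim B < s"
  then have "hausdorff_outer_measure s A = 0"
    using hausdorff_outer_measure_mono[OF assms, of s] hausdorff_outer_measure_eq_0_above_dim[OF s]
    by simp
  then show "hausdorff_dim A \<le> s"
    using s hausdorff_dim_nonneg[of B] by (intro hausdorff_dim_le) auto
qed

lemma hausdorff_dim_UN_le:
  assumes "\<And>n :: nat. hausdorff_dim (A n) \<le> a"
  shows "hausdorff_dim (\<Union>n. A n) \<le> a"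
proof (rule dense_ge)
  fix s assume s: "a < s"
  have "0 \<le> s"
    using s assms[of 0] hausdorff_dim_nonneg[of "A 0"] by linarith
  moreover have "hausdorff_outer_measure s (\<Union>n. A n) = 0"
    by (intro hausdorff_outer_measure_UN_eq_0 hausdorff_outer_measure_eq_0_above_dim
        le_less_trans[OF assms s])
  ultimately show "hausdorff_dim (\<Union>n. A n) \<le> s" by (rule hausdorff_dim_le)
qed


section \<open>The Hausdorff integral of a nonnegative function\<close>

text \<open>
  On the support of \<open>h\<close> and on the whole of \<open>K\<close> the integral is the same; the latter domain does
  not vary along a sequence of functions.
\<close>
lemma hausdorff_integral_nonneg:
  assumes "\<And>x. x \<in> K \<Longrightarrow> 0 \<le> h x"
  shows "hausdorff_integral K h =
    (let d = hausdorff_dim (hausdorff_support K h)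
     in (d, enn2ereal (\<integral>\<^sup>+x\<in>K. ennreal (h x) \<partial>hausdorff_measure d)))"
proof -
  have pos: "(\<integral>\<^sup>+x\<in>hausdorff_support K h. ennreal (h x) \<partial>M) = (\<integral>\<^sup>+x\<in>K. ennreal (h x) \<partial>M)" for M
    by (rule nn_integral_cong) (auto simp: hausdorff_support_def indicator_def)
  have "(\<lambda>x. ennreal (- h x) * indicator (hausdorff_support K h) x) = (\<lambda>_. 0)"
    using assms by (auto simp: hausdorff_support_def indicator_def ennreal_neg)
  then have neg: "(\<integral>\<^sup>+x\<in>hausdorff_support K h. ennreal (- h x) \<partial>M) = 0" for M
    by (simp only: nn_integral_const mult_zero_left)
  show ?thesis
    unfolding hausdorff_integral_def Let_def pos neg by (simp add: zero_ennreal.rep_eq)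
qed

lemma hausdorff_integral_nonneg_in_carrier:
  assumes "\<And>x. x \<in> K \<Longrightarrow> 0 \<le> h x"
  shows "hausdorff_integral K h \<in> {0..1} \<times> {0..}"
  using assms
  by (simp add: hausdorff_integral_nonneg Let_def hausdorff_dim_nonneg hausdorff_dim_le_1)

lemma hausdorff_integral_null_support:
  assumes nonneg: "\<And>x. x \<in> K \<Longrightarrow> 0 \<le> h x"
    and D: "hausdorff_support K h \<in> sets borel"
    and null: "hausdorff_outer_measure (hausdorff_dim (hausdorff_support K h)) (hausdorff_support K h) = 0"
  shows "hausdorff_integral K h = (hausdorff_dim (hausdorff_support K h), 0)"
proof -
  let ?D = "hausdorff_support K h"
  let ?M = "hausdorff_measure (hausdorff_dim ?D)"
  have "?D \<in> null_sets ?M"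
    using D null by (auto simp: null_sets_def emeasure_hausdorff_measure hausdorff_dim_nonneg)
  then have "(\<integral>\<^sup>+x\<in>?D. ennreal (h x) \<partial>?M) = 0"
    by (rule nn_integral_null_set)
  moreover have "(\<integral>\<^sup>+x\<in>K. ennreal (h x) \<partial>?M) = (\<integral>\<^sup>+x\<in>?D. ennreal (h x) \<partial>?M)"
    by (rule nn_integral_cong) (auto simp: hausdorff_support_def indicator_def)
  ultimately show ?thesis
    using nonneg by (simp add: hausdorff_integral_nonneg Let_def zero_ennreal.rep_eq)
qed


section \<open>Monotone convergence\<close>

theorem theorem2p39:
  fixes K :: "real set" and f :: "nat \<Rightarrow> real \<Rightarrow> real" and g :: "real \<Rightarrow> real"
  assumes "K \<in> sets borel"
    and "\<And>n. f n \<in> borel_measurable (restrict_space borel K)"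
    and "\<And>n x. x \<in> K \<Longrightarrow> 0 \<le> f n x"
    and "\<And>n x. x \<in> K \<Longrightarrow> f n x \<le> f (Suc n) x"
    and "\<And>x. x \<in> K \<Longrightarrow> (\<lambda>n. f n x) \<longlonglongrightarrow> g x"
  shows "limitin hausdorff_value_topology
           (\<lambda>n. hausdorff_integral K (f n)) (hausdorff_integral K g) sequentially"
proof -
  have inc: "incseq (\<lambda>n. f n x)" if "x \<in> K" for x
    using assms(4)[OF that] by (rule incseq_SucI)
  have f_le_g: "f n x \<le> g x" if "x \<in> K" for n x
    using incseq_le[OF inc[OF that] assms(5)[OF that]] .
  have g_nonneg: "0 \<le> g x" if "x \<in> K" for x
    using assms(3)[OF that, of 0] f_le_g[OF that, of 0] by linarith

  define D where "D n = hausdorff_support K (f n)" for n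
  define E where "E = hausdorff_support K g"
  define d where "d = hausdorff_dim E"
  define I where "I s h = enn2ereal (\<integral>\<^sup>+x\<in>K. ennreal (h x) \<partial>hausdorff_measure s)"
    for s and h :: "real \<Rightarrow> real"
  have Hf: "hausdorff_integral K (f n) = (hausdorff_dim (D n), I (hausdorff_dim (D n)) (f n))" for n
    using assms(3) by (simp add: hausdorff_integral_nonneg Let_def D_def I_def)
  have Hg: "hausdorff_integral K g = (d, I d g)"
    using g_nonneg by (simp add: hausdorff_integral_nonneg Let_def d_def E_def I_def)

  have D_mono: "D m \<subseteq> D n" if "m \<le> n" for m n
  proof
    fix x assume "x \<in> D m"
    then have x: "x \<in> K" "f m x \<noteq> 0" by (auto simp: D_def hausdorff_support_def)
    then show "x \<in> D n"
      using assms(3)[OF x(1), of m] incseqD[OF inc[OF x(1)] that]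
      by (auto simp: D_def hausdorff_support_def)
  qed
  have E: "E = (\<Union>n. D n)"
  proof
    show "E \<subseteq> (\<Union>n. D n)"
    proof
      fix x assume "x \<in> E"
      then have x: "x \<in> K" "g x \<noteq> 0" by (auto simp: E_def hausdorff_support_def)
      have "\<exists>n. f n x \<noteq> 0"
      proof (rule ccontr)
        assume "\<nexists>n. f n x \<noteq> 0"
        then have "(\<lambda>n. f n x) = (\<lambda>_. 0)" by simp
        then show False
          using assms(5)[OF x(1)] x(2) by (simp add: LIMSEQ_const_iff)
      qed
      then show "x \<in> (\<Union>n. D n)" using x by (auto simp: D_def hausdorff_support_def)
    qed
    show "(\<Union>n. D n) \<subseteq> E"
    proof
      fix x assume "x \<in> (\<Union>n. D n)"
      then obtain n where x: "x \<in> K" "f n x \<noteq> 0" by (auto simp: D_def hausdorff_support_def)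
      then show "x \<in> E"
        using assms(3)[OF x(1), of n] f_le_g[OF x(1), of n] by (auto simp: E_def hausdorff_support_def)
    qed
  qed
  have dim_le: "hausdorff_dim (D n) \<le> d" for n
    unfolding d_def by (rule hausdorff_dim_mono) (auto simp: E)
  have dim_mono: "hausdorff_dim (D m) \<le> hausdorff_dim (D n)" if "m \<le> n" for m n
    by (rule hausdorff_dim_mono[OF D_mono[OF that]])
  have dim_gt: "\<forall>\<^sub>F n in sequentially. a < hausdorff_dim (D n)" if a: "a < d" for a
  proof -
    have "\<not> (\<forall>n. hausdorff_dim (D n) \<le> a)"
      using a hausdorff_dim_UN_le[of D a] by (auto simp: d_def E)
    then obtain N where "a < hausdorff_dim (D N)"
      by (auto simp: not_le)
    then have "a < hausdorff_dim (D n)" if "N \<le> n" for n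
      using dim_mono[OF that] by linarith
    then show ?thesis
      unfolding eventually_sequentially by blast
  qed
  have I_mono: "I s (f n) \<le> I s g" for s n
    unfolding I_def less_eq_ennreal.rep_eq[symmetric]
    by (intro nn_integral_mono) (auto simp: indicator_def intro!: ennreal_leI f_le_g)

  have meas: "(\<lambda>x. ennreal (f n x) * indicator K x) \<in> borel_measurable borel" for n
  proof -
    have "(\<lambda>x. ennreal (f n x)) \<in> borel_measurable (restrict_space borel K)"
      using assms(2) by measurable
    then show ?thesis
      using assms(1) by (simp add: borel_measurable_restrict_space_iff_ennreal)
  qed
  have I_lim: "(\<lambda>n. I s (f n)) \<longlonglongrightarrow> I s g" for s
  proof -
    have "(\<lambda>n. \<integral>\<^sup>+x\<in>K. ennreal (f n x) \<partial>hausdorff_measure s)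
        \<longlonglongrightarrow> (\<integral>\<^sup>+x\<in>K. ennreal (g x) \<partial>hausdorff_measure s)"
    proof (rule nn_integral_LIMSEQ)
      show "incseq (\<lambda>n x. ennreal (f n x) * indicator K x)"
        using assms(4) by (intro incseq_SucI le_funI) (auto simp: indicator_def intro: ennreal_leI)
      show "(\<lambda>x. ennreal (f n x) * indicator K x) \<in> borel_measurable (hausdorff_measure s)" for n
        using meas by simp
      show "(\<lambda>n. ennreal (f n x) * indicator K x) \<longlonglongrightarrow> ennreal (g x) * indicator K x" for x
        using assms(5) by (auto simp: indicator_def intro: tendsto_ennrealI)
    qed
    then show ?thesis
      unfolding I_def by (rule tendsto_enn2erealI)
  qed

  show ?thesis
  proof (rule limitin_hausdorff_value_topology_belowI)
    show "hausdorff_integral K g \<in> {0..1} \<times> {0..}"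
      using g_nonneg by (rule hausdorff_integral_nonneg_in_carrier)
    show "hausdorff_integral K (f n) \<in> {0..1} \<times> {0..}" for n
      using assms(3) by (rule hausdorff_integral_nonneg_in_carrier)
    show "lex_le (hausdorff_integral K (f n)) (hausdorff_integral K g)" for n
      using dim_le[of n] I_mono[of d n] by (auto simp: Hf Hg lex_le_def)
  next
    fix a :: "real \<times> ereal"
    assume a: "a \<in> {0..1} \<times> {0..}" "lex_le a (hausdorff_integral K g)" "a \<noteq> hausdorff_integral K g"
    then consider "fst a < d" | "fst a = d" "snd a < I d g"
      by (cases a) (auto simp: Hg lex_le_def)
    then show "\<forall>\<^sub>F n in sequentially.
        lex_le a (hausdorff_integral K (f n)) \<and> hausdorff_integral K (f n) \<noteq> a"
    proof cases
      case 1
      from dim_gt[OF 1] show ?thesis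
        by eventually_elim (auto simp: Hf lex_le_def)
    next
      case 2
      \<comment> \<open>Otherwise the support of \<open>g\<close> is null and nothing fits strictly below its second component.\<close>
      have "\<exists>N. hausdorff_dim (D N) = d"
      proof (rule ccontr)
        assume "\<nexists>N. hausdorff_dim (D N) = d"
        then have "hausdorff_dim (D n) < d" for n
          using dim_le[of n] by (auto simp: less_le)
        then have "hausdorff_outer_measure d E = 0"
          unfolding E by (intro hausdorff_outer_measure_UN_eq_0 hausdorff_outer_measure_eq_0_above_dim)
        moreover have "E \<in> sets borel"
        proof -
          have "x \<in> D n \<longleftrightarrow> ennreal (f n x) * indicator K x \<noteq> 0" for n x
          proof (cases "x \<in> K")
            case True
            then have "ennreal (f n x) = 0 \<longleftrightarrow> f n x = 0"
              using assms(3)[OF True, of n] by simp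
            with True show ?thesis by (simp add: D_def hausdorff_support_def)
          qed (simp add: D_def hausdorff_support_def)
          then have "D n = (\<lambda>x. ennreal (f n x) * indicator K x) -` (- {0}) \<inter> space borel" for n
            by auto
          then have "D n \<in> sets borel" for n
            using measurable_sets[OF meas[of n], of "- {0}"] by simp
          then show ?thesis unfolding E by blast
        qed
        ultimately have "I d g = 0"
          using hausdorff_integral_null_support[of K g] g_nonneg Hg by (simp add: E_def d_def)
        then show False using a(1) 2 by auto
      qed
      then obtain N where N: "hausdorff_dim (D N) = d" ..
      have "\<forall>\<^sub>F n in sequentially. snd a < I d (f n)"
        using I_lim 2(2) by (rule order_tendstoD)
      moreover have "\<forall>\<^sub>F n in sequentially. N \<le> n"
        by (rule eventually_ge_at_top)
      ultimately show ?thesis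
      proof eventually_elim
        case (elim n)
        then have "hausdorff_dim (D n) = d"
          using dim_le[of n] dim_mono[of N n] N by linarith
        then show ?case
          using elim 2 by (auto simp: Hf lex_le_def)
      qed
    qed
  qed
qed

end
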